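(* Let $(X,d)$ be a complete metric space, let $D_1$ be a relatively dense subset of $\mathbb{R}^+$, let $D_2$ be a relatively dense subset of $\mathbb{R}$, and let $u\in BC(\mathbb{R},X)$. The following statements are equivalent. (i) $u\in AP(\mathbb{R},X)$, i.e. $u$ is almost periodic. (ii) The set $\{T_\tau u : \tau\in D_1\}$ is relatively compact in $(BC(\mathbb{R},X),d_\infty)$. (iii) The set $\{R(T_\tau u) : \tau\in D_2\}$ is relatively compact in $(BC(\mathbb{R}^+,X),d_{\infty,+})$.
   Context: $\mathbb{R}^+=[0,+\infty)$. For a metric space $(X,d)$ and $J=\mathbb{R}$ or $J=\mathbb{R}^+$, $BC(J,X)$ is the space of all bounded continuous functions from $J$ to $X$, with the metric $d_\infty(u,v)=\sup_{t\in\mathbb{R}}d(u(t),v(t))$ when $J=\mathbb{R}$, and $d_{\infty,+}(u,v)=\sup_{t\ge 0}d(u(t),v(t))$ when $J=\mathbb{R}^+$. For $\tau\in\mathbb{R}$ and $u\in BC(\mathbb{R},X)$, the translate $T_\tau u\in BC(\mathbb{R},X)$ is $T_\tau u(t)=u(t+\tau)$, $t\in\mathbb{R}$. The restriction operator $R:BC(\mathbb{R},X)\to BC(\mathbb{R}^+,X)$ is $R(u)(t)=u(t)$ for $t\ge 0$. A subset $D$ of $\mathbb{R}$ (respectively of $\mathbb{R}^+$) is relatively dense in $\mathbb{R}$ (respectively in $\mathbb{R}^+$) if there is $\ell>0$ such that $D\cap[\alpha,\alpha+\ell]\neq\emptyset$ for all $\alpha\in\mathbb{R}$ (respectively for all $\alpha\ge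 0$). A continuous function $u:\mathbb{R}\to X$ is almost periodic (in the sense of Bohr) if for each $\varepsilon>0$ the set $\{\tau\in\mathbb{R} : \sup_{t\in\mathbb{R}}d(u(t+\tau),u(t))\le\varepsilon\}$ is relatively dense in $\mathbb{R}$; $AP(\mathbb{R},X)$ denotes the set of such functions. A subset of a metric space is relatively compact if its closure is compact. *)

theory Defs
  imports "HOL-Analysis.Analysis"
begin

text \<open>
  A metric space \<open>(X,d)\<close> is an element \<open>m :: 'a metric\<close>, with \<open>X = mspace m\<close> and \<open>d = mdist m\<close>.
  The library's \<^const>\<open>cfunspace\<close> consists of the bounded continuous functions with the supremum
  metric; its elements are extensional, i.e. equal to \<^const>\<open>undefined\<close> outside \<open>J\<close>, which is no
  restriction for \<open>J = UNIV\<close>.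
\<close>

definition BC :: "real set \<Rightarrow> 'a metric \<Rightarrow> (real \<Rightarrow> 'a) metric" where
  "BC J m = cfunspace (top_of_set J) m"

definition translate :: "real \<Rightarrow> (real \<Rightarrow> 'a) \<Rightarrow> real \<Rightarrow> 'a" where
  "translate \<tau> u = (\<lambda>t. u (t + \<tau>))"

definition restr_nonneg :: "(real \<Rightarrow> 'a) \<Rightarrow> real \<Rightarrow> 'a" where
  "restr_nonneg u = restrict u {0..}"

definition relatively_dense_in :: "real set \<Rightarrow> real set \<Rightarrow> bool" where
  "relatively_dense_in J D \<longleftrightarrow>
     D \<subseteq> J \<and> (\<exists>l>0. \<forall>\<alpha>\<in>J. D \<inter> {\<alpha>..\<alpha> + l} \<noteq> {})"

text \<open>
  The supremum is taken in the extended reals: \<open>u\<close> is not assumed to be bounded here, and the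
  supremum of an unbounded set in type \<^typ>\<open>real\<close> would be unspecified.
\<close>

definition AP :: "'a metric \<Rightarrow> (real \<Rightarrow> 'a) set" where
  "AP m = {u. continuous_map euclidean (mtopology_of m) u \<and>
     (\<forall>\<epsilon>>0. relatively_dense_in UNIV
        {\<tau>. (SUP t. ereal (mdist m (u (t + \<tau>)) (u t))) \<le> ereal \<epsilon>})}"

definition relatively_compact_in :: "'b metric \<Rightarrow> 'b set \<Rightarrow> bool" where
  "relatively_compact_in M S \<longleftrightarrow>
     S \<subseteq> mspace M \<and> compactin (mtopology_of M) (mtopology_of M closure_of S)"

end

theory Submission
  imports Defs
begin

text \<open>
  Because \<open>X\<close> is complete, so are the spaces of bounded continuous functions, and relative
  compactness of a family of translates of \<open>u\<close> means that for every \<open>\<epsilon>\<close> finitely many of them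
  approximate all the others up to \<open>\<epsilon>\<close>, uniformly on \<open>J = \<real>\<close> or on \<open>J = [0, \<infinity>)\<close>
  (\<open>relatively_compact_translates_iff_finite_nets\<close>). Both equivalences are then statements about
  finite nets and almost periods.

  If \<open>u\<close> is almost periodic, then it is uniformly continuous, and an almost period carries any
  shift \<open>\<tau>\<close> into a fixed compact interval \<open>[0, l]\<close>, on which finitely many shifts suffice. So the
  set of all translates has finite nets on \<open>\<real>\<close>, a fortiori on the half line, and relative
  compactness passes to the subfamilies given by \<open>D\<^sub>1\<close> and \<open>D\<^sub>2\<close>.

  Conversely, when the translates by \<open>\<tau>\<close> and \<open>\<sigma>\<close> are \<open>\<epsilon>\<close>-close on \<open>\<real>\<close>, the difference
  \<open>\<tau> - \<sigma>\<close> is an \<open>\<epsilon>\<close>-almost period. With \<open>\<sigma>\<close> from a finite net and \<open>\<tau>\<close> running through a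
  relatively dense set, such differences are relatively dense in the same half line or line as the
  \<open>\<tau>\<close>. For \<open>D\<^sub>1\<close> this covers the positive half line only, and the symmetry of the set of almost
  periods gives the negative one.

  For \<open>D\<^sub>2\<close> the closeness is known on \<open>[0, \<infinity>)\<close> only, so the difference \<open>p = \<tau> - \<sigma>\<close> is at first an
  almost period of \<open>u\<close> on some half line \<open>[b, \<infinity>)\<close>. Since \<open>D\<^sub>2\<close> is unbounded below, one of the finitely
  many classes of shifts close to a given net point \<open>\<sigma>\<^sub>0\<close> contains arbitrarily negative \<open>\<tau>'\<close>. Then
  \<open>q = \<sigma>\<^sub>0 - \<tau>'\<close> is large and is an almost period on the half line \<open>[\<tau>', \<infinity>)\<close>, which reaches as far to
  the left as desired. Moving \<open>t\<close> and \<open>t + p\<close> by \<open>q\<close> to the right of \<open>b\<close> shows that \<open>p\<close> is a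
  \<open>3\<epsilon>\<close>-almost period on all of \<open>\<real>\<close> (\<open>half_line_almost_period_extends\<close>).
\<close>

section \<open>Relative compactness as the existence of finite nets\<close>

text \<open>
  Total boundedness of the translates of \<open>u\<close> by \<open>D\<close> in the supremum distance over \<open>J\<close>, written
  pointwise so that restrictions and suprema disappear from the arguments about \<open>u\<close>.
\<close>

definition finite_nets :: "real set \<Rightarrow> 'a metric \<Rightarrow> (real \<Rightarrow> 'a) \<Rightarrow> real set \<Rightarrow> bool" where
  "finite_nets J m u D \<longleftrightarrow>
     (\<forall>\<epsilon>>0. \<exists>K. finite K \<and> K \<subseteq> D \<and>
        (\<forall>\<tau>\<in>D. \<exists>\<sigma>\<in>K. \<forall>t\<in>J. mdist m (u (t + \<tau>)) (u (t + \<sigma>)) \<le> \<epsilon>))"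

lemma mcomplete_of_BC:
  assumes "mcomplete_of m"
  shows "mcomplete_of (BC J m)"
proof -
  interpret Metric_space "mspace m" "mdist m"
    by simp
  have "Self = m"
    by (simp add: Self_def)
  then show ?thesis
    using mcomplete_cfunspace[of "top_of_set J"] assms
    by (simp add: BC_def mcomplete_of_def)
qed

lemma relatively_compact_in_iff_mtotally_bounded:
  assumes "mcomplete_of M"
  shows "relatively_compact_in M S \<longleftrightarrow> Metric_space.mtotally_bounded (mspace M) (mdist M) S"
  using Metric_space.mtotally_bounded_eq_compact_closure_of[OF Metric_space_mspace_mdist] assms
  by (auto simp: relatively_compact_in_def mtopology_of_def mcomplete_of_def)

lemma relatively_compact_in_subset:
  assumes "relatively_compact_in M S" "T \<subseteq> S"
  shows "relatively_compact_in M T"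
  using assms closed_compactin[of "mtopology_of M" "mtopology_of M closure_of S" "mtopology_of M closure_of T"]
  by (auto simp: relatively_compact_in_def closure_of_mono)

lemma restrict_translate_in_BC:
  assumes "u \<in> mspace (BC UNIV m)"
  shows "restrict (translate \<tau> u) J \<in> mspace (BC J m)"
proof -
  have bd: "Metric_space.mbounded (mspace m) (mdist m) (range u)"
    and cont: "continuous_map euclidean (mtopology_of m) u" and "range u \<subseteq> mspace m"
    using assms by (auto simp: BC_def)
  have "continuous_map (top_of_set J) euclidean (\<lambda>t. t + \<tau>)"
    by (simp add: continuous_map_iff_continuous2 continuous_intros)
  from continuous_map_compose[OF this cont]
  have "continuous_map (top_of_set J) (mtopology_of m) (restrict (translate \<tau> u) J)"
    by (rule continuous_map_eq) (auto simp: translate_def)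
  moreover have "Metric_space.mbounded (mspace m) (mdist m) (restrict (translate \<tau> u) J ` J)"
    by (rule Metric_space.mbounded_subset[OF Metric_space_mspace_mdist bd])
       (auto simp: translate_def)
  ultimately show ?thesis
    using \<open>range u \<subseteq> mspace m\<close> by (auto simp: BC_def translate_def)
qed

text \<open>
  A nonempty \<open>J\<close> is essential: over the empty set the distance is zero by convention, so for
  negative \<open>\<epsilon>\<close> the left side would fail while the right side holds vacuously.
\<close>

lemma mdist_restrict_translate_le:
  assumes "u \<in> mspace (BC UNIV m)" "J \<noteq> {}"
  shows "mdist (BC J m) (restrict (translate \<tau> u) J) (restrict (translate \<sigma> u) J) \<le> \<epsilon> \<longleftrightarrow>
           (\<forall>t\<in>J. mdist m (u (t + \<tau>)) (u (t + \<sigma>)) \<le> \<epsilon>)"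
proof -
  note in_BC = restrict_translate_in_BC[OF assms(1), unfolded BC_def]
  have "topspace (top_of_set J) \<noteq> {}"
    using assms(2) by simp
  from cfunspace_mdist_le[OF in_BC in_BC this]
  show ?thesis
    by (simp add: BC_def translate_def)
qed

lemma relatively_compact_translates_iff_finite_nets:
  assumes "mcomplete_of m" "u \<in> mspace (BC UNIV m)" "J \<noteq> {}"
  shows "relatively_compact_in (BC J m) ((\<lambda>\<tau>. restrict (translate \<tau> u) J) ` D)
           \<longleftrightarrow> finite_nets J m u D"
proof -
  let ?r = "\<lambda>\<tau>. restrict (translate \<tau> u) J"
  interpret B: Metric_space "mspace (BC J m)" "mdist (BC J m)"
    by simp
  note in_BC = restrict_translate_in_BC[OF assms(2)]
  note dist_le = mdist_restrict_translate_le[OF assms(2,3)]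
  have "B.mtotally_bounded (?r ` D) \<longleftrightarrow> finite_nets J m u D"
  proof
    assume tb: "B.mtotally_bounded (?r ` D)"
    show "finite_nets J m u D"
      unfolding finite_nets_def
    proof (intro allI impI)
      fix \<epsilon> :: real assume "\<epsilon> > 0"
      then obtain F where F: "finite F" "F \<subseteq> ?r ` D" "?r ` D \<subseteq> (\<Union>f\<in>F. B.mball f \<epsilon>)"
        using tb[unfolded B.mtotally_bounded_def, rule_format, OF \<open>\<epsilon> > 0\<close>] by metis
      then obtain K where K: "K \<subseteq> D" "finite K" "F = ?r ` K"
        using finite_subset_image[OF F(1,2)] by metis
      have "\<exists>\<sigma>\<in>K. \<forall>t\<in>J. mdist m (u (t + \<tau>)) (u (t + \<sigma>)) \<le> \<epsilon>" if "\<tau> \<in> D" for \<tau>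
      proof -
        obtain \<sigma> where "\<sigma> \<in> K" "mdist (BC J m) (?r \<sigma>) (?r \<tau>) < \<epsilon>"
          using F(3) K(3) \<open>\<tau> \<in> D\<close> by (auto simp: image_subset_iff)
        then have "mdist (BC J m) (?r \<tau>) (?r \<sigma>) \<le> \<epsilon>"
          by (metis less_imp_le mdist_commute)
        then show ?thesis
          using \<open>\<sigma> \<in> K\<close> dist_le by blast
      qed
      then show "\<exists>K. finite K \<and> K \<subseteq> D \<and>
          (\<forall>\<tau>\<in>D. \<exists>\<sigma>\<in>K. \<forall>t\<in>J. mdist m (u (t + \<tau>)) (u (t + \<sigma>)) \<le> \<epsilon>)"
        using K(1,2) by (intro exI[of _ K]) simp
    qed
  next
    assume nets: "finite_nets J m u D"
    show "B.mtotally_bounded (?r ` D)"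
      unfolding B.mtotally_bounded_def
    proof (intro allI impI)
      fix \<epsilon> :: real assume "\<epsilon> > 0"
      then have "\<epsilon>/2 > 0"
        by simp
      from nets[unfolded finite_nets_def, rule_format, OF this]
      obtain K where K: "finite K" "K \<subseteq> D"
        "\<forall>\<tau>\<in>D. \<exists>\<sigma>\<in>K. \<forall>t\<in>J. mdist m (u (t + \<tau>)) (u (t + \<sigma>)) \<le> \<epsilon>/2"
        by metis
      have "?r \<tau> \<in> (\<Union>\<sigma>\<in>K. B.mball (?r \<sigma>) \<epsilon>)" if "\<tau> \<in> D" for \<tau>
      proof -
        obtain \<sigma> where "\<sigma> \<in> K" "\<forall>t\<in>J. mdist m (u (t + \<tau>)) (u (t + \<sigma>)) \<le> \<epsilon>/2"
          using K(3) \<open>\<tau> \<in> D\<close> by blast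
        then have "mdist (BC J m) (?r \<tau>) (?r \<sigma>) \<le> \<epsilon>/2"
          by (simp only: dist_le)
        then have "mdist (BC J m) (?r \<sigma>) (?r \<tau>) < \<epsilon>"
          using \<open>\<epsilon> > 0\<close> by (simp add: mdist_commute)
        then show ?thesis
          using \<open>\<sigma> \<in> K\<close> in_BC by auto
      qed
      then show "\<exists>F. finite F \<and> F \<subseteq> ?r ` D \<and> ?r ` D \<subseteq> (\<Union>f\<in>F. B.mball f \<epsilon>)"
        using K(1,2) by (intro exI[of _ "?r ` K"]) auto
    qed
  qed
  then show ?thesis
    using relatively_compact_in_iff_mtotally_bounded mcomplete_of_BC[OF assms(1)] by blast
qed

section \<open>Almost periods\<close>

definition almost_periods :: "'a metric \<Rightarrow> (real \<Rightarrow> 'a) \<Rightarrow> real \<Rightarrow> real set" where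
  "almost_periods m u \<epsilon> = {\<tau>. \<forall>t. mdist m (u (t + \<tau>)) (u t) \<le> \<epsilon>}"

text \<open>
  The supremum in the definition is taken in the extended reals, so bounding it amounts to
  bounding every value.
\<close>

lemma AP_iff_almost_periods:
  "u \<in> AP m \<longleftrightarrow> continuous_map euclidean (mtopology_of m) u \<and>
     (\<forall>\<epsilon>>0. relatively_dense_in UNIV (almost_periods m u \<epsilon>))"
  by (simp add: AP_def almost_periods_def SUP_le_iff)

lemma uminus_in_almost_periods:
  assumes "\<tau> \<in> almost_periods m u \<epsilon>"
  shows "- \<tau> \<in> almost_periods m u \<epsilon>"
  unfolding almost_periods_def
proof (intro CollectI allI)
  fix t
  have "mdist m (u (t - \<tau> + \<tau>)) (u (t - \<tau>)) \<le> \<epsilon>"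
    using assms unfolding almost_periods_def by blast
  then show "mdist m (u (t + - \<tau>)) (u t) \<le> \<epsilon>"
    by (simp add: mdist_commute)
qed

text \<open>
  Reflection settles the windows on the negative side, and a window that is on neither side
  contains zero.
\<close>

lemma relatively_dense_in_UNIV_symmetric:
  assumes "0 \<in> P" "\<And>p. p \<in> P \<Longrightarrow> - p \<in> P"
    and "l > 0" "\<And>\<alpha>. \<alpha> \<ge> 0 \<Longrightarrow> P \<inter> {\<alpha>..\<alpha> + l} \<noteq> {}"
  shows "relatively_dense_in UNIV P"
proof -
  have "P \<inter> {\<alpha>..\<alpha> + l} \<noteq> {}" for \<alpha>
  proof -
    consider "\<alpha> \<ge> 0" | "\<alpha> + l \<le> 0" | "\<alpha> \<le> 0" "0 \<le> \<alpha> + l"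
      by linarith
    then show ?thesis
    proof cases
      case 2
      then obtain p where "p \<in> P" "- (\<alpha> + l) \<le> p" "p \<le> - \<alpha>"
        using assms(4)[of "- (\<alpha> + l)"] by auto
      then show ?thesis
        using assms(2)[of p] by (auto intro!: exI[of _ "- p"])
    qed (use assms in auto)
  qed
  then show ?thesis
    using \<open>l > 0\<close> unfolding relatively_dense_in_def by blast
qed

text \<open>
  Subtracting elements of a finite set moves points by at most some \<open>b\<close>, so windows that are longer
  by \<open>2 * b\<close> catch a difference. The window for \<open>\<tau>\<close> starts at \<open>\<alpha> + b\<close>, which is still in \<open>J\<close> as \<open>J\<close>
  is closed upwards; this treats the line and the half line at once.
\<close>

lemma differences_relatively_dense:
  assumes "relatively_dense_in J D" "\<And>a b. a \<in> J \<Longrightarrow> a \<le> b \<Longrightarrow> b \<in> J"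
    and "finite K" "\<And>\<tau>. \<tau> \<in> D \<Longrightarrow> \<exists>\<sigma>\<in>K. \<tau> - \<sigma> \<in> P"
  obtains l where "l > 0" "\<And>\<alpha>. \<alpha> \<in> J \<Longrightarrow> P \<inter> {\<alpha>..\<alpha> + l} \<noteq> {}"
proof -
  obtain l where l: "l > 0" "\<And>\<alpha>. \<alpha> \<in> J \<Longrightarrow> D \<inter> {\<alpha>..\<alpha> + l} \<noteq> {}"
    using assms(1) unfolding relatively_dense_in_def by blast
  obtain b where b: "b > 0" "\<And>\<sigma>. \<sigma> \<in> K \<Longrightarrow> \<bar>\<sigma>\<bar> \<le> b"
    using finite_imp_bounded[OF \<open>finite K\<close>] by (auto simp: bounded_pos)
  have "P \<inter> {\<alpha>..\<alpha> + (l + 2 * b)} \<noteq> {}" if "\<alpha> \<in> J" for \<alpha>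
  proof -
    have "\<alpha> + b \<in> J"
      using that assms(2) b(1) by (meson less_add_same_cancel1 less_imp_le)
    then obtain \<tau> where "\<tau> \<in> D" "\<alpha> + b \<le> \<tau>" "\<tau> \<le> \<alpha> + b + l"
      using l(2)[of "\<alpha> + b"] by auto
    moreover obtain \<sigma> where "\<sigma> \<in> K" "\<tau> - \<sigma> \<in> P"
      using assms(4) \<open>\<tau> \<in> D\<close> by blast
    moreover have "\<bar>\<sigma>\<bar> \<le> b"
      using b(2) \<open>\<sigma> \<in> K\<close> by blast
    ultimately have "\<tau> - \<sigma> \<in> P \<inter> {\<alpha>..\<alpha> + (l + 2 * b)}"
      by auto
    then show ?thesis
      by blast
  qed
  then show thesis
    using that[of "l + 2 * b"] l(1) b(1) by simp
qed

section \<open>Almost periodic functions have finite nets of translates\<close>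

text \<open>
  Almost periods move any two nearby points into one compact interval, where continuity is
  uniform.
\<close>

lemma AP_uniformly_continuous:
  assumes "u \<in> AP m" "\<epsilon> > 0"
  obtains \<delta> where "\<delta> > 0" "\<And>s t. \<bar>s - t\<bar> < \<delta> \<Longrightarrow> mdist m (u s) (u t) \<le> \<epsilon>"
proof -
  have cont: "continuous_map euclidean (mtopology_of m) u"
    and "relatively_dense_in UNIV (almost_periods m u (\<epsilon>/3))"
    using assms by (auto simp: AP_iff_almost_periods)
  then obtain l where "l > 0" and l: "\<And>\<alpha>. almost_periods m u (\<epsilon>/3) \<inter> {\<alpha>..\<alpha> + l} \<noteq> {}"
    unfolding relatively_dense_in_def by blast
  have u_in: "u t \<in> mspace m" for t
    using continuous_map_image_subset_topspace[OF cont] by auto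
  have triangle: "mdist m (u r) (u t) \<le> mdist m (u r) (u s) + mdist m (u s) (u t)" for r t s
    using mdist_triangle u_in by metis
  \<comment> \<open>A margin of \<open>1\<close> around \<open>[0, l]\<close>: moving \<open>t\<close> into \<open>[0, l]\<close> takes any \<open>s\<close> closer than \<open>1\<close> into \<open>?I\<close>.\<close>
  let ?I = "submetric euclidean_metric {-1..l + 1}"
  have unif: "uniformly_continuous_map ?I m u"
    by (rule continuous_imp_uniformly_continuous_map)
       (simp add: mtopology_of_submetric compact_space_subtopology
         continuous_map_from_subtopology[OF cont])
  obtain \<delta> where "\<delta> > 0" and
    \<delta>: "\<And>s t. s \<in> {-1..l + 1} \<Longrightarrow> t \<in> {-1..l + 1} \<Longrightarrow> \<bar>s - t\<bar> < \<delta> \<Longrightarrow> mdist m (u s) (u t) < \<epsilon>/3"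
  proof -
    have "\<epsilon>/3 > 0"
      using \<open>\<epsilon> > 0\<close> by simp
    with unif obtain \<delta> where "\<delta> > 0" "\<forall>t\<in>mspace ?I. \<forall>s\<in>mspace ?I.
        mdist ?I s t < \<delta> \<longrightarrow> mdist m (u s) (u t) < \<epsilon>/3"
      unfolding uniformly_continuous_map_def by blast
    then show thesis
      using that[of \<delta>] by (simp add: dist_real_def)
  qed
  have "mdist m (u s) (u t) \<le> \<epsilon>" if "\<bar>s - t\<bar> < min \<delta> 1" for s t
  proof -
    obtain p where p: "p \<in> almost_periods m u (\<epsilon>/3)" "- t \<le> p" "p \<le> - t + l"
      using l[of "- t"] by auto
    have "mdist m (u (s + p)) (u s) \<le> \<epsilon>/3" "mdist m (u (t + p)) (u t) \<le> \<epsilon>/3"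
      using p(1) by (auto simp: almost_periods_def)
    moreover have "mdist m (u (s + p)) (u (t + p)) < \<epsilon>/3"
      using p that by (intro \<delta>) auto
    ultimately show ?thesis
      using triangle[of s t "s + p"] triangle[of "s + p" t "t + p"] mdist_commute[of m "u s" "u (s + p)"]
      by linarith
  qed
  then show thesis
    using that[of "min \<delta> 1"] \<open>\<delta> > 0\<close> by simp
qed

text \<open>
  An almost period \<open>p\<close> with \<open>\<tau> + p \<in> [0, l]\<close> reduces the shift \<open>\<tau>\<close> to one in a compact interval, and
  by uniform continuity close shifts give uniformly close translates.
\<close>

lemma AP_imp_finite_nets:
  assumes "u \<in> AP m"
  shows "finite_nets J m u UNIV"
  unfolding finite_nets_def
proof (intro allI impI)
  fix \<epsilon> :: real assume "\<epsilon> > 0"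
  then obtain l where l: "\<And>\<alpha>. almost_periods m u (\<epsilon>/2) \<inter> {\<alpha>..\<alpha> + l} \<noteq> {}"
    using assms unfolding AP_iff_almost_periods relatively_dense_in_def by (meson UNIV_I half_gt_zero)
  obtain \<delta> where "\<delta> > 0" and \<delta>: "\<And>s t. \<bar>s - t\<bar> < \<delta> \<Longrightarrow> mdist m (u s) (u t) \<le> \<epsilon>/2"
    using AP_uniformly_continuous[OF assms, of "\<epsilon>/2"] \<open>\<epsilon> > 0\<close> by (metis half_gt_zero)
  have u_in: "u t \<in> mspace m" for t
    using assms continuous_map_image_subset_topspace[of euclidean "mtopology_of m" u]
    by (auto simp: AP_def)
  obtain K where K: "finite K" "{0..l} \<subseteq> (\<Union>\<sigma>\<in>K. ball \<sigma> \<delta>)"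
    using seq_compact_imp_totally_bounded[of "{0..l}"] \<open>\<delta> > 0\<close>
    by (metis compact_Icc compact_imp_seq_compact)
  have "\<exists>\<sigma>\<in>K. \<forall>t\<in>J. mdist m (u (t + \<tau>)) (u (t + \<sigma>)) \<le> \<epsilon>" for \<tau>
  proof -
    obtain p where p: "p \<in> almost_periods m u (\<epsilon>/2)" "- \<tau> \<le> p" "p \<le> - \<tau> + l"
      using l[of "- \<tau>"] by auto
    then have "\<tau> + p \<in> {0..l}"
      by auto
    then obtain \<sigma> where \<sigma>: "\<sigma> \<in> K" "\<bar>\<tau> + p - \<sigma>\<bar> < \<delta>"
      using K(2) by (fastforce simp: dist_real_def)
    have "mdist m (u (t + \<tau>)) (u (t + \<sigma>)) \<le> \<epsilon>" for t
    proof -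
      have "mdist m (u (t + \<tau> + p)) (u (t + \<tau>)) \<le> \<epsilon>/2"
        using p(1) by (auto simp: almost_periods_def)
      moreover have "mdist m (u (t + \<tau> + p)) (u (t + \<sigma>)) \<le> \<epsilon>/2"
        using \<sigma>(2) by (intro \<delta>) linarith
      ultimately show ?thesis
        using mdist_triangle[OF u_in[of "t + \<tau>"] u_in[of "t + \<tau> + p"] u_in[of "t + \<sigma>"]]
          mdist_commute[of m "u (t + \<tau>)" "u (t + \<tau> + p)"]
        by linarith
    qed
    then show ?thesis
      using \<sigma>(1) by blast
  qed
  then show "\<exists>K. finite K \<and> K \<subseteq> UNIV \<and>
      (\<forall>\<tau>\<in>UNIV. \<exists>\<sigma>\<in>K. \<forall>t\<in>J. mdist m (u (t + \<tau>)) (u (t + \<sigma>)) \<le> \<epsilon>)"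
    using K(1) by blast
qed

section \<open>Finite nets of translates force almost periodicity\<close>

lemma finite_nets_imp_AP:
  assumes cont: "continuous_map euclidean (mtopology_of m) u"
    and D: "relatively_dense_in {0..} D" and nets: "finite_nets UNIV m u D"
  shows "u \<in> AP m"
  unfolding AP_iff_almost_periods
proof (intro conjI allI impI cont)
  fix \<epsilon> :: real assume "\<epsilon> > 0"
  then obtain K where "finite K"
    and K: "\<And>\<tau>. \<tau> \<in> D \<Longrightarrow> \<exists>\<sigma>\<in>K. \<forall>t. mdist m (u (t + \<tau>)) (u (t + \<sigma>)) \<le> \<epsilon>"
    using nets unfolding finite_nets_def by (meson UNIV_I)
  have "\<exists>\<sigma>\<in>K. \<tau> - \<sigma> \<in> almost_periods m u \<epsilon>" if "\<tau> \<in> D" for \<tau>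
  proof -
    obtain \<sigma> where \<sigma>: "\<sigma> \<in> K" "\<And>t. mdist m (u (t + \<tau>)) (u (t + \<sigma>)) \<le> \<epsilon>"
      using K[OF \<open>\<tau> \<in> D\<close>] by blast
    have "mdist m (u (t + (\<tau> - \<sigma>))) (u t) \<le> \<epsilon>" for t
      using \<sigma>(2)[of "t - \<sigma>"] by (simp add: algebra_simps)
    then show ?thesis
      using \<sigma>(1) by (auto simp: almost_periods_def)
  qed
  then obtain l where "l > 0" "\<And>\<alpha>. \<alpha> \<in> {0..} \<Longrightarrow> almost_periods m u \<epsilon> \<inter> {\<alpha>..\<alpha> + l} \<noteq> {}"
    using differences_relatively_dense[OF D _ \<open>finite K\<close>, of "almost_periods m u \<epsilon>"] by auto
  moreover have "0 \<in> almost_periods m u \<epsilon>"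
  proof -
    have "u t \<in> mspace m" for t
      using continuous_map_image_subset_topspace[OF cont] by auto
    then have "mdist m (u t) (u t) = 0" for t
      by (simp only: mdist_zero)
    then show ?thesis
      using \<open>\<epsilon> > 0\<close> by (simp add: almost_periods_def)
  qed
  ultimately show "relatively_dense_in UNIV (almost_periods m u \<epsilon>)"
    using relatively_dense_in_UNIV_symmetric uminus_in_almost_periods by (metis atLeast_iff)
qed

text \<open>
  Compare \<open>u (t + p)\<close> with \<open>u (t + q + p)\<close>, then with \<open>u (t + q)\<close>, then with \<open>u t\<close>. The middle step
  needs \<open>t + q \<ge> b\<close>, and the outer ones need \<open>q\<close> to be an almost period at \<open>t + p\<close> and at \<open>t\<close>. Hence
  \<open>q\<close> must be large and at the same time valid far to the left.
\<close>

lemma half_line_almost_period_extends: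
  assumes u_in: "\<And>t. u t \<in> mspace m"
    and p: "\<And>t. t \<ge> b \<Longrightarrow> mdist m (u (t + p)) (u t) \<le> \<epsilon>"
    and q: "\<And>s. \<exists>q\<ge>s. \<forall>t\<ge>- s. mdist m (u (t + q)) (u t) \<le> \<epsilon>"
  shows "p \<in> almost_periods m u (3 * \<epsilon>)"
  unfolding almost_periods_def
proof (intro CollectI allI)
  fix t
  obtain q where "q \<ge> \<bar>t\<bar> + \<bar>p\<bar> + \<bar>b\<bar>"
    and q: "\<And>r. r \<ge> - (\<bar>t\<bar> + \<bar>p\<bar> + \<bar>b\<bar>) \<Longrightarrow> mdist m (u (r + q)) (u r) \<le> \<epsilon>"
    using q by blast
  then have "mdist m (u (t + q + p)) (u (t + q)) \<le> \<epsilon>"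
    by (intro p) linarith
  moreover have "mdist m (u (t + q)) (u t) \<le> \<epsilon>"
    by (rule q) linarith
  moreover have "mdist m (u (t + p)) (u (t + q + p)) \<le> \<epsilon>"
    using q[of "t + p"] by (simp add: algebra_simps mdist_commute)
  ultimately show "mdist m (u (t + p)) (u t) \<le> 3 * \<epsilon>"
    using mdist_triangle[OF u_in[of "t + p"] u_in[of "t + q + p"] u_in[of t]]
      mdist_triangle[OF u_in[of "t + q + p"] u_in[of "t + q"] u_in[of t]]
    by linarith
qed

lemma finite_cover_unbounded_below:
  fixes D :: "real set"
  assumes "finite K" "D \<subseteq> (\<Union>\<sigma>\<in>K. A \<sigma>)" "\<not> bdd_below D"
  obtains \<sigma> where "\<sigma> \<in> K" "\<not> bdd_below (A \<sigma>)"
proof -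
  have "\<not> bdd_below (\<Union>\<sigma>\<in>K. A \<sigma>)"
    using bdd_below_mono[OF _ assms(2)] assms(3) by metis
  then show thesis
    using that bdd_below_UN[OF \<open>finite K\<close>] by metis
qed

text \<open>
  Total boundedness on the half line suffices because the shifts extend to minus infinity: some
  class of mutually close shifts does so too, and its members yield the large almost periods on
  half lines \<open>[- s, \<infinity>)\<close> that extend the differences \<open>\<tau> - \<sigma>\<close> from a half line to the whole line.
\<close>

lemma half_line_finite_nets_imp_AP:
  assumes cont: "continuous_map euclidean (mtopology_of m) u"
    and D: "relatively_dense_in UNIV D" and nets: "finite_nets {0..} m u D"
  shows "u \<in> AP m"
  unfolding AP_iff_almost_periods
proof (intro conjI allI impI cont)
  fix \<epsilon> :: real assume "\<epsilon> > 0"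
  have u_in: "u t \<in> mspace m" for t
    using continuous_map_image_subset_topspace[OF cont] by auto
  \<comment> \<open>A third of \<open>\<epsilon>\<close>, as extending an almost period from a half line costs a factor of three.\<close>
  define A where "A \<sigma> = {\<tau>. \<forall>t\<ge>0. mdist m (u (t + \<tau>)) (u (t + \<sigma>)) \<le> \<epsilon>/3}" for \<sigma>
  obtain K where "finite K" and K: "D \<subseteq> (\<Union>\<sigma>\<in>K. A \<sigma>)"
  proof -
    have "\<epsilon>/3 > 0"
      using \<open>\<epsilon> > 0\<close> by simp
    then obtain K where "finite K"
      "\<forall>\<tau>\<in>D. \<exists>\<sigma>\<in>K. \<forall>t\<in>{0..}. mdist m (u (t + \<tau>)) (u (t + \<sigma>)) \<le> \<epsilon>/3"
      using nets unfolding finite_nets_def by blast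
    then show thesis
      using that[of K] unfolding A_def by blast
  qed
  obtain b where b: "\<And>\<sigma>. \<sigma> \<in> K \<Longrightarrow> \<bar>\<sigma>\<bar> \<le> b"
    using finite_imp_bounded[OF \<open>finite K\<close>] by (auto simp: bounded_pos)
  have "\<not> bdd_below D"
  proof
    assume "bdd_below D"
    then obtain c where c: "\<And>\<tau>. \<tau> \<in> D \<Longrightarrow> c \<le> \<tau>"
      by (auto simp: bdd_below_def)
    obtain l where "l > 0" "\<And>\<alpha>. D \<inter> {\<alpha>..\<alpha> + l} \<noteq> {}"
      using D unfolding relatively_dense_in_def by blast
    then obtain \<tau> where "\<tau> \<in> D" "\<tau> \<le> c - l - 1 + l"
      by (metis IntE atLeastAtMost_iff ex_in_conv)
    then show False
      using c[of \<tau>] by simp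
  qed
  then obtain \<sigma>0 where "\<sigma>0 \<in> K" and \<sigma>0: "\<not> bdd_below (A \<sigma>0)"
    by (rule finite_cover_unbounded_below[OF \<open>finite K\<close> K])
  \<comment> \<open>Substituting \<open>t - \<tau>\<close> for \<open>t\<close>: the more negative \<open>\<tau>\<close> is, the larger the half line.\<close>
  have shift: "mdist m (u (t + (\<sigma> - \<tau>))) (u t) \<le> \<epsilon>/3" if "\<tau> \<in> A \<sigma>" "t \<ge> \<tau>" for \<sigma> \<tau> t
  proof -
    have "mdist m (u (r + \<tau>)) (u (r + \<sigma>)) \<le> \<epsilon>/3" if "r \<ge> 0" for r
      using \<open>\<tau> \<in> A \<sigma>\<close> that unfolding A_def by blast
    from this[of "t - \<tau>"] \<open>t \<ge> \<tau>\<close>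
    have "mdist m (u (t - \<tau> + \<tau>)) (u (t - \<tau> + \<sigma>)) \<le> \<epsilon>/3"
      by linarith
    then show ?thesis
      by (simp add: algebra_simps mdist_commute)
  qed
  have q: "\<exists>q\<ge>s. \<forall>t\<ge>- s. mdist m (u (t + q)) (u t) \<le> \<epsilon>/3" for s
  proof -
    obtain \<tau> where "\<tau> \<in> A \<sigma>0" "\<tau> < min (- s) (\<sigma>0 - s)"
      using \<sigma>0 unfolding bdd_below_def by (meson not_le)
    then show ?thesis
      using shift[of \<tau> \<sigma>0] by (intro exI[of _ "\<sigma>0 - \<tau>"]) auto
  qed
  have "\<exists>\<sigma>\<in>K. \<tau> - \<sigma> \<in> almost_periods m u \<epsilon>" if "\<tau> \<in> D" for \<tau>
  proof -
    obtain \<sigma> where "\<sigma> \<in> K" and \<sigma>: "\<tau> \<in> A \<sigma>"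
      using K \<open>\<tau> \<in> D\<close> by blast
    have "mdist m (u (t + (\<tau> - \<sigma>))) (u t) \<le> \<epsilon>/3" if "t \<ge> b" for t
    proof -
      have "t - \<sigma> \<ge> 0"
        using b[OF \<open>\<sigma> \<in> K\<close>] that by linarith
      then have "mdist m (u (t - \<sigma> + \<tau>)) (u (t - \<sigma> + \<sigma>)) \<le> \<epsilon>/3"
        using \<sigma> unfolding A_def by blast
      then show ?thesis
        by (simp add: algebra_simps)
    qed
    then have "\<tau> - \<sigma> \<in> almost_periods m u (3 * (\<epsilon>/3))"
      using half_line_almost_period_extends[OF u_in _ q] by blast
    then show ?thesis
      using \<open>\<sigma> \<in> K\<close> by auto
  qed
  then obtain l where "l > 0" "\<And>\<alpha>. almost_periods m u \<epsilon> \<inter> {\<alpha>..\<alpha> + l} \<noteq> {}"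
    using differences_relatively_dense[OF D _ \<open>finite K\<close>, of "almost_periods m u \<epsilon>"] by auto
  then show "relatively_dense_in UNIV (almost_periods m u \<epsilon>)"
    unfolding relatively_dense_in_def by blast
qed

section \<open>The equivalence\<close>

theorem corollary4p1:
  fixes m :: "'a metric" and D1 D2 :: "real set" and u :: "real \<Rightarrow> 'a"
  assumes "mcomplete_of m"
    and "relatively_dense_in {0..} D1"
    and "relatively_dense_in UNIV D2"
    and "u \<in> mspace (BC UNIV m)"
  shows "(u \<in> AP m \<longleftrightarrow>
            relatively_compact_in (BC UNIV m) {translate \<tau> u | \<tau>. \<tau> \<in> D1})
       \<and> (u \<in> AP m \<longleftrightarrow>
            relatively_compact_in (BC {0..} m) {restr_nonneg (translate \<tau> u) | \<tau>. \<tau> \<in> D2})"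
proof -
  let ?S = "\<lambda>J D. (\<lambda>\<tau>. restrict (translate \<tau> u) J) ` D"
  have cont: "continuous_map euclidean (mtopology_of m) u"
    using assms(4) by (simp add: BC_def)
  \<comment> \<open>The nets are found among all translates, whence the detour through \<open>UNIV\<close>.\<close>
  have AP_imp: "relatively_compact_in (BC J m) (?S J D)" if "u \<in> AP m" "J \<noteq> {}" for J D
  proof (rule relatively_compact_in_subset)
    show "relatively_compact_in (BC J m) (?S J UNIV)"
      using relatively_compact_translates_iff_finite_nets[OF assms(1,4) that(2)]
        AP_imp_finite_nets[OF that(1)] by blast
  qed auto
  have "u \<in> AP m \<longleftrightarrow> relatively_compact_in (BC UNIV m) (?S UNIV D1)"
    using AP_imp[of UNIV D1] finite_nets_imp_AP[OF cont assms(2)]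
      relatively_compact_translates_iff_finite_nets[OF assms(1,4), of UNIV D1] by auto
  moreover have "u \<in> AP m \<longleftrightarrow> relatively_compact_in (BC {0..} m) (?S {0..} D2)"
    using AP_imp[of "{0..}" D2] half_line_finite_nets_imp_AP[OF cont assms(3)]
      relatively_compact_translates_iff_finite_nets[OF assms(1,4), of "{0..}" D2] by auto
  moreover have "{translate \<tau> u | \<tau>. \<tau> \<in> D1} = ?S UNIV D1"
    by (simp add: Setcompr_eq_image restrict_def)
  moreover have "{restr_nonneg (translate \<tau> u) | \<tau>. \<tau> \<in> D2} = ?S {0..} D2"
    by (simp add: Setcompr_eq_image restr_nonneg_def)
  ultimately show ?thesis
    by simp
qed

end
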